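(* Let $p$ be an odd prime and $r\geq 1$ an integer, and let $G$ be an extraspecial group of order $p^{2r+1}$ and exponent $p^2$. Then there exists a semiregular relative difference set in $G$ with parameters $(p^{2r},p,p^{2r},p^{2r-1})$.
   Context: For a finite group $G$ and $X\subseteq G$, write $\underline{X}=\sum_{x\in X}x\in\mathbb{Z}G$ and $X^{(-1)}=\{x^{-1}:x\in X\}$; $e$ is the identity. For a subgroup $N\leq G$ (not necessarily normal), a subset $X\subseteq G$ is a relative difference set (RDS) relative to $N$ with parameters $(m,n,k,\lambda)$ if $\underline{X}\cdot\underline{X^{(-1)}}=ke+\lambda(\underline{G}-\underline{N})$, where $k=|X|$, $m=|G:N|$, $n=|N|$, and $\lambda$ is a positive integer. It is semiregular if $|X\cap Ng|=1$ for all $g\in G$. *)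

theory Defs
  imports "HOL-Algebra.Multiplicative_Group" "HOL-Computational_Algebra.Primes"
begin

(* The integral group ring of a finite group G: an element is its coefficient function, which
   vanishes off carrier G.  For infinite G the sum in the product would be meaningless. *)

definition int_group_ring :: "('a, 'b) monoid_scheme \<Rightarrow> ('a \<Rightarrow> int) ring" where
  "int_group_ring G =
     \<lparr>carrier = {f. \<forall>x. x \<notin> carrier G \<longrightarrow> f x = 0},
      monoid.mult = (\<lambda>f g x. \<Sum>(y, z) | y \<in> carrier G \<and> z \<in> carrier G \<and> y \<otimes>\<^bsub>G\<^esub> z = x. f y * g z),
      one = (\<lambda>x. if x = \<one>\<^bsub>G\<^esub> then 1 else 0),
      zero = (\<lambda>x. 0),
      add = (\<lambda>f g x. f x + g x)\<rparr>"

definition subset_sum :: "'a set \<Rightarrow> 'a \<Rightarrow> int" where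
  "subset_sum D = (\<lambda>x. if x \<in> D then 1 else 0)"

lemma int_group_ring_mult_apply:
  assumes "finite (carrier G)"
  shows "(f \<otimes>\<^bsub>int_group_ring G\<^esub> g) x =
    (\<Sum>y\<in>carrier G. \<Sum>z\<in>carrier G. if y \<otimes>\<^bsub>G\<^esub> z = x then f y * g z else 0)"
proof -
  have "(f \<otimes>\<^bsub>int_group_ring G\<^esub> g) x =
      (\<Sum>(y, z)\<in>{p \<in> carrier G \<times> carrier G. fst p \<otimes>\<^bsub>G\<^esub> snd p = x}. f y * g z)"
    by (auto simp: int_group_ring_def intro!: sum.cong)
  also have "\<dots> = (\<Sum>p\<in>carrier G \<times> carrier G.
      if fst p \<otimes>\<^bsub>G\<^esub> snd p = x then f (fst p) * g (snd p) else 0)"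
    using assms by (subst sum.inter_filter) (auto simp: case_prod_beta intro!: sum.cong)
  finally show ?thesis
    by (simp add: sum.cartesian_product case_prod_beta)
qed

lemma ring_int_group_ring:
  fixes G (structure)
  assumes "group G" and fin: "finite (carrier G)"
  shows "ring (int_group_ring G)"
proof -
  interpret group G by fact
  note app = int_group_ring_mult_apply[OF fin]
  let ?R = "int_group_ring G" and ?C = "carrier G"
  have mult_closed: "f \<otimes>\<^bsub>?R\<^esub> g \<in> carrier ?R" for f g
    by (auto simp: int_group_ring_def intro!: sum.neutral)
  have left: "((f \<otimes>\<^bsub>?R\<^esub> g) \<otimes>\<^bsub>?R\<^esub> h) x =
      (\<Sum>a\<in>?C. \<Sum>b\<in>?C. \<Sum>c\<in>?C. if a \<otimes>\<^bsub>G\<^esub> b \<otimes>\<^bsub>G\<^esub> c = x then f a * g b * h c else 0)" for f g h x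
  proof -
    have "((f \<otimes>\<^bsub>?R\<^esub> g) \<otimes>\<^bsub>?R\<^esub> h) x =
      (\<Sum>u\<in>?C. \<Sum>c\<in>?C. \<Sum>a\<in>?C. \<Sum>b\<in>?C.
        if a \<otimes>\<^bsub>G\<^esub> b = u then if u \<otimes>\<^bsub>G\<^esub> c = x then f a * g b * h c else 0 else 0)"
      unfolding app by (intro sum.cong refl) (auto simp: sum_distrib_right intro!: sum.cong sum.neutral)
    also have "\<dots> = (\<Sum>u\<in>?C. \<Sum>a\<in>?C. \<Sum>c\<in>?C. \<Sum>b\<in>?C.
        if a \<otimes>\<^bsub>G\<^esub> b = u then if u \<otimes>\<^bsub>G\<^esub> c = x then f a * g b * h c else 0 else 0)"
      by (intro sum.cong refl sum.swap)
    also have "\<dots> = (\<Sum>a\<in>?C. \<Sum>u\<in>?C. \<Sum>c\<in>?C. \<Sum>b\<in>?C.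
        if a \<otimes>\<^bsub>G\<^esub> b = u then if u \<otimes>\<^bsub>G\<^esub> c = x then f a * g b * h c else 0 else 0)"
      by (rule sum.swap)
    also have "\<dots> = (\<Sum>a\<in>?C. \<Sum>u\<in>?C. \<Sum>b\<in>?C. \<Sum>c\<in>?C.
        if a \<otimes>\<^bsub>G\<^esub> b = u then if u \<otimes>\<^bsub>G\<^esub> c = x then f a * g b * h c else 0 else 0)"
      by (intro sum.cong refl sum.swap)
    also have "\<dots> = (\<Sum>a\<in>?C. \<Sum>b\<in>?C. \<Sum>u\<in>?C. \<Sum>c\<in>?C.
        if a \<otimes>\<^bsub>G\<^esub> b = u then if u \<otimes>\<^bsub>G\<^esub> c = x then f a * g b * h c else 0 else 0)"
      by (intro sum.cong refl sum.swap)
    also have "\<dots> = (\<Sum>a\<in>?C. \<Sum>b\<in>?C. \<Sum>c\<in>?C. \<Sum>u\<in>?C.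
        if a \<otimes>\<^bsub>G\<^esub> b = u then if u \<otimes>\<^bsub>G\<^esub> c = x then f a * g b * h c else 0 else 0)"
      by (intro sum.cong refl sum.swap)
    finally show ?thesis
      using fin by (simp add: sum.delta')
  qed
  have right: "(f \<otimes>\<^bsub>?R\<^esub> (g \<otimes>\<^bsub>?R\<^esub> h)) x =
      (\<Sum>a\<in>?C. \<Sum>b\<in>?C. \<Sum>c\<in>?C. if a \<otimes>\<^bsub>G\<^esub> b \<otimes>\<^bsub>G\<^esub> c = x then f a * g b * h c else 0)" for f g h x
  proof -
    have "(f \<otimes>\<^bsub>?R\<^esub> (g \<otimes>\<^bsub>?R\<^esub> h)) x =
      (\<Sum>a\<in>?C. \<Sum>u\<in>?C. \<Sum>b\<in>?C. \<Sum>c\<in>?C.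
        if b \<otimes>\<^bsub>G\<^esub> c = u then if a \<otimes>\<^bsub>G\<^esub> u = x then f a * g b * h c else 0 else 0)"
      unfolding app by (intro sum.cong refl) (auto simp: sum_distrib_left mult.assoc intro!: sum.cong sum.neutral)
    also have "\<dots> = (\<Sum>a\<in>?C. \<Sum>b\<in>?C. \<Sum>u\<in>?C. \<Sum>c\<in>?C.
        if b \<otimes>\<^bsub>G\<^esub> c = u then if a \<otimes>\<^bsub>G\<^esub> u = x then f a * g b * h c else 0 else 0)"
      by (intro sum.cong refl sum.swap)
    also have "\<dots> = (\<Sum>a\<in>?C. \<Sum>b\<in>?C. \<Sum>c\<in>?C. \<Sum>u\<in>?C.
        if b \<otimes>\<^bsub>G\<^esub> c = u then if a \<otimes>\<^bsub>G\<^esub> u = x then f a * g b * h c else 0 else 0)"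
      by (intro sum.cong refl sum.swap)
    finally show ?thesis
      using fin by (simp add: sum.delta' m_assoc)
  qed
  have one_apply: "\<one>\<^bsub>?R\<^esub> x = (if x = \<one> then 1 else 0)" for x
    by (simp add: int_group_ring_def)
  have l_one: "\<one>\<^bsub>?R\<^esub> \<otimes>\<^bsub>?R\<^esub> f = f" if "f \<in> carrier ?R" for f
  proof
    fix x
    have "(\<one>\<^bsub>?R\<^esub> \<otimes>\<^bsub>?R\<^esub> f) x =
        (\<Sum>y\<in>?C. if y = \<one> then \<Sum>z\<in>?C. if z = x then f z else 0 else 0)"
      unfolding app by (intro sum.cong) (auto simp: one_apply intro!: sum.cong sum.neutral)
    then show "(\<one>\<^bsub>?R\<^esub> \<otimes>\<^bsub>?R\<^esub> f) x = f x"
      using fin that by (auto simp: int_group_ring_def)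
  qed
  have r_one: "f \<otimes>\<^bsub>?R\<^esub> \<one>\<^bsub>?R\<^esub> = f" if "f \<in> carrier ?R" for f
  proof
    fix x
    have "(f \<otimes>\<^bsub>?R\<^esub> \<one>\<^bsub>?R\<^esub>) x =
        (\<Sum>y\<in>?C. \<Sum>z\<in>?C. if z = \<one> then if y = x then f y else 0 else 0)"
      unfolding app by (intro sum.cong) (auto simp: one_apply)
    then show "(f \<otimes>\<^bsub>?R\<^esub> \<one>\<^bsub>?R\<^esub>) x = f x"
      using fin that by (auto simp: int_group_ring_def)
  qed
  have add_apply: "(f \<oplus>\<^bsub>?R\<^esub> g) x = f x + g x" for f g x
    by (simp add: int_group_ring_def)
  show ?thesis
  proof (rule ringI)
    show "abelian_group ?R"
    proof (rule abelian_groupI)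
      show "\<exists>g\<in>carrier ?R. g \<oplus>\<^bsub>?R\<^esub> f = \<zero>\<^bsub>?R\<^esub>" if "f \<in> carrier ?R" for f
        using that by (intro bexI[of _ "\<lambda>x. - f x"]) (auto simp: int_group_ring_def)
    qed (auto simp: int_group_ring_def algebra_simps)
    show "Group.monoid ?R"
    proof (rule monoidI)
      show "\<one>\<^bsub>?R\<^esub> \<in> carrier ?R"
        by (auto simp: int_group_ring_def)
      show "(f \<otimes>\<^bsub>?R\<^esub> g) \<otimes>\<^bsub>?R\<^esub> h = f \<otimes>\<^bsub>?R\<^esub> (g \<otimes>\<^bsub>?R\<^esub> h)" for f g h
        by (rule ext) (simp add: left right)
    qed (auto intro: mult_closed l_one r_one)
    show "(f \<oplus>\<^bsub>?R\<^esub> g) \<otimes>\<^bsub>?R\<^esub> h = f \<otimes>\<^bsub>?R\<^esub> h \<oplus>\<^bsub>?R\<^esub> g \<otimes>\<^bsub>?R\<^esub> h" for f g h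
      by (rule ext)
        (auto simp: add_apply app sum.distrib[symmetric] distrib_right intro!: sum.cong)
    show "h \<otimes>\<^bsub>?R\<^esub> (f \<oplus>\<^bsub>?R\<^esub> g) = h \<otimes>\<^bsub>?R\<^esub> f \<oplus>\<^bsub>?R\<^esub> h \<otimes>\<^bsub>?R\<^esub> g" for f g h
      by (rule ext)
        (auto simp: add_apply app sum.distrib[symmetric] distrib_left intro!: sum.cong)
  qed
qed

definition relative_difference_set ::
  "('a, 'b) monoid_scheme \<Rightarrow> 'a set \<Rightarrow> 'a set \<Rightarrow> nat \<Rightarrow> nat \<Rightarrow> nat \<Rightarrow> nat \<Rightarrow> bool" where
  "relative_difference_set G N D m n k l \<longleftrightarrow>
     group G \<and> finite (carrier G) \<and> subgroup N G \<and> D \<subseteq> carrier G \<and>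
     m = card (rcosets\<^bsub>G\<^esub> N) \<and> n = card N \<and> k = card D \<and> 0 < l \<and>
     (let R = int_group_ring G in
       subset_sum D \<otimes>\<^bsub>R\<^esub> subset_sum (set_inv\<^bsub>G\<^esub> D) =
       [k] \<cdot>\<^bsub>R\<^esub> \<one>\<^bsub>R\<^esub> \<oplus>\<^bsub>R\<^esub> [l] \<cdot>\<^bsub>R\<^esub> (subset_sum (carrier G) \<ominus>\<^bsub>R\<^esub> subset_sum N))"

definition semiregular_rds ::
  "('a, 'b) monoid_scheme \<Rightarrow> 'a set \<Rightarrow> 'a set \<Rightarrow> nat \<Rightarrow> nat \<Rightarrow> nat \<Rightarrow> nat \<Rightarrow> bool" where
  "semiregular_rds G N D m n k l \<longleftrightarrow>
     relative_difference_set G N D m n k l \<and>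
     (\<forall>g\<in>carrier G. card (D \<inter> (N #>\<^bsub>G\<^esub> g)) = 1)"

lemma relative_difference_set_iff_coeff:
  fixes G (structure)
  assumes "group G" and fin: "finite (carrier G)" and N: "subgroup N G"
  shows "relative_difference_set G N D m n k l \<longleftrightarrow>
     D \<subseteq> carrier G \<and> m = card (rcosets\<^bsub>G\<^esub> N) \<and> n = card N \<and> k = card D \<and> 0 < l \<and>
     (\<forall>g\<in>carrier G.
       int (card {(x, y) \<in> D \<times> D. x \<otimes>\<^bsub>G\<^esub> inv\<^bsub>G\<^esub> y = g}) =
       (if g = \<one>\<^bsub>G\<^esub> then int k else 0) + (if g \<in> N then 0 else int l))"
proof (cases "D \<subseteq> carrier G")
  case D: True
  interpret group G by fact
  let ?R = "int_group_ring G"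
  interpret R: ring ?R by (rule ring_int_group_ring) fact+
  have NG: "N \<subseteq> carrier G" using N by (rule subgroup.subset)
  have memR: "subset_sum A \<in> carrier ?R" if "A \<subseteq> carrier G" for A
    using that by (auto simp: int_group_ring_def subset_sum_def)
  have fX: "finite D" using D fin by (rule finite_subset)
  have pow: "([j] \<cdot>\<^bsub>?R\<^esub> f) x = int j * f x" for f x and j :: nat
    by (induction j)
      (simp_all add: add_pow_def int_group_ring_def nat_pow_def algebra_simps)
  have neg: "\<ominus>\<^bsub>?R\<^esub> f = (\<lambda>x. - f x)" if "f \<in> carrier ?R" for f
    by (rule R.minus_equality) (use that in \<open>auto simp: int_group_ring_def\<close>)
  have rhs: "([k] \<cdot>\<^bsub>?R\<^esub> \<one>\<^bsub>?R\<^esub> \<oplus>\<^bsub>?R\<^esub> [l] \<cdot>\<^bsub>?R\<^esub> (subset_sum (carrier G) \<ominus>\<^bsub>?R\<^esub> subset_sum N)) g =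
      (if g \<in> carrier G
       then (if g = \<one> then int k else 0) + (if g \<in> N then 0 else int l) else 0)" for g
  proof -
    have add: "(f \<oplus>\<^bsub>?R\<^esub> h) g = f g + h g" for f h
      by (simp add: int_group_ring_def)
    have one: "\<one>\<^bsub>?R\<^esub> g = (if g = \<one> then 1 else 0)"
      by (simp add: int_group_ring_def)
    show ?thesis
      unfolding add pow one a_minus_def neg[OF memR[OF NG]] using NG by (auto simp: subset_sum_def)
  qed
  have lhs: "(subset_sum D \<otimes>\<^bsub>?R\<^esub> subset_sum (set_inv D)) g =
      int (card {(x, y) \<in> D \<times> D. x \<otimes> inv y = g})" for g
  proof -
    let ?S = "{(y, z). y \<in> carrier G \<and> z \<in> carrier G \<and> y \<otimes> z = g}"
    let ?T = "{(y, z). y \<in> D \<and> z \<in> set_inv D \<and> y \<otimes> z = g}"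
    have "?S \<subseteq> carrier G \<times> carrier G" by auto
    then have fS: "finite ?S" using fin by (auto intro: finite_subset)
    have TS: "?T \<subseteq> ?S" using D by (auto simp: SET_INV_def)
    have "(subset_sum D \<otimes>\<^bsub>?R\<^esub> subset_sum (set_inv D)) g =
        (\<Sum>(y, z)\<in>?S. subset_sum D y * subset_sum (set_inv D) z)"
      by (simp add: int_group_ring_def)
    also have "\<dots> = (\<Sum>(y, z)\<in>?T. 1)"
      by (rule sum.mono_neutral_cong_right[OF fS TS]) (auto simp: subset_sum_def split: if_splits)
    also have "\<dots> = int (card ?T)" by (simp add: case_prod_beta)
    also have "card ?T = card {(x, y) \<in> D \<times> D. x \<otimes> inv y = g}"
    proof (rule card_bij_eq[of "\<lambda>(y, z). (y, inv z)" _ _ "\<lambda>(y, z). (y, inv z)"])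
      show "finite ?T" by (rule finite_subset[OF TS fS])
      show "finite {(x, y) \<in> D \<times> D. x \<otimes> inv y = g}"
        using fX by (auto intro: finite_subset[of _ "D \<times> D"])
      show "inj_on (\<lambda>(y, z). (y, inv z)) ?T"
        using D by (auto simp: inj_on_def SET_INV_def subset_iff)
      show "inj_on (\<lambda>(y, z). (y, inv z)) {(x, y) \<in> D \<times> D. x \<otimes> inv y = g}"
        using D by (auto simp: inj_on_def subset_iff)
      show "(\<lambda>(y, z). (y, inv z)) ` ?T \<subseteq> {(x, y) \<in> D \<times> D. x \<otimes> inv y = g}"
        using D by (auto simp: SET_INV_def subset_iff)
      show "(\<lambda>(y, z). (y, inv z)) ` {(x, y) \<in> D \<times> D. x \<otimes> inv y = g} \<subseteq> ?T"
        using D by (auto simp: SET_INV_def)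
    qed
    finally show ?thesis .
  qed
  have off: "card {(x, y) \<in> D \<times> D. x \<otimes> inv y = g} = 0" if "g \<notin> carrier G" for g
  proof -
    have "{(x, y) \<in> D \<times> D. x \<otimes> inv y = g} = {}" using D that by auto
    then show ?thesis by (simp only: card.empty)
  qed
  show ?thesis
    unfolding relative_difference_set_def Let_def fun_eq_iff lhs rhs
    using assms D off by auto
qed (auto simp: relative_difference_set_def)

definition group_center :: "('a, 'b) monoid_scheme \<Rightarrow> 'a set" where
  "group_center G = {z \<in> carrier G. \<forall>x\<in>carrier G. z \<otimes>\<^bsub>G\<^esub> x = x \<otimes>\<^bsub>G\<^esub> z}"

definition group_exponent :: "('a, 'b) monoid_scheme \<Rightarrow> nat" where
  "group_exponent G = (LEAST n. 0 < n \<and> (\<forall>x\<in>carrier G. x [^]\<^bsub>G\<^esub> n = \<one>\<^bsub>G\<^esub>))"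

definition elementary_abelian :: "nat \<Rightarrow> ('a, 'b) monoid_scheme \<Rightarrow> bool" where
  "elementary_abelian p G \<longleftrightarrow> comm_group G \<and> (\<forall>x\<in>carrier G. x [^]\<^bsub>G\<^esub> p = \<one>\<^bsub>G\<^esub>)"

definition extraspecial :: "nat \<Rightarrow> ('a, 'b) monoid_scheme \<Rightarrow> bool" where
  "extraspecial p G \<longleftrightarrow>
     prime p \<and> group G \<and> finite (carrier G) \<and> (\<exists>a. order G = p ^ a) \<and>
     card (group_center G) = p \<and>
     elementary_abelian p (G Mod group_center G) \<and> order (G Mod group_center G) \<noteq> 1"

end

theory Submission
  imports Defs
begin

text \<open>
  Take \<open>N = Z\<close>, the centre. The \<open>p\<close>-th power map is an endomorphism because \<open>p\<close> is odd. Let \<open>A\<close> be maximal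
  among the abelian subgroups of exponent dividing \<open>p\<close> that meet \<open>Z\<close> trivially, and let \<open>C\<close> be its
  centralizer. By maximality the elements of \<open>C\<close> with trivial \<open>p\<close>-th power form \<open>AZ\<close>, so \<open>C / AZ\<close> embeds
  into \<open>Z\<close> by the power map, and \<open>C\<close> is abelian. Let \<open>f : G \<rightarrow> Z\<close> be \<open>Z\<close>-equivariant and invariant under
  right multiplication by \<open>A\<close>, let \<open>t(x)\<close> be a fixed representative of \<open>xC\<close>, and put
  \<open>F(x) = f(t\<inverse>x) [t, x]\<inverse>\<close> with \<open>t = t(x)\<close>. The difference set is \<open>F\<inverse>(1)\<close>: one needs
  \<open>\<rho>(x) = F(gx) F(x)\<inverse>\<close> to be equidistributed on \<open>Z\<close> for every \<open>g \<notin> Z\<close>. If \<open>g \<notin> C\<close>, translation by some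
  \<open>h \<in> A\<close> multiplies \<open>\<rho>\<close> by \<open>[g, h]\<inverse> \<noteq> 1\<close>. If \<open>g \<in> C\<close>, permuting the representatives \<open>t\<close> by some \<open>k\<close>
  multiplies \<open>\<rho>\<close> by \<open>[k, g]\<^sup>-\<^sup>2 \<noteq> 1\<close>.
\<close>

section \<open>Commutators and the centre of a group\<close>

definition commutator :: "('a, 'b) monoid_scheme \<Rightarrow> 'a \<Rightarrow> 'a \<Rightarrow> 'a" where
  "commutator G x y = x \<otimes>\<^bsub>G\<^esub> y \<otimes>\<^bsub>G\<^esub> inv\<^bsub>G\<^esub> x \<otimes>\<^bsub>G\<^esub> inv\<^bsub>G\<^esub> y"

context group
begin

lemma commutator_closed [simp, intro]:
  "x \<in> carrier G \<Longrightarrow> y \<in> carrier G \<Longrightarrow> commutator G x y \<in> carrier G"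
  by (simp add: commutator_def)

lemma mult_eq_commutator_mult:
  "x \<in> carrier G \<Longrightarrow> y \<in> carrier G \<Longrightarrow> x \<otimes> y = commutator G x y \<otimes> (y \<otimes> x)"
  using inv_solve_right[of "commutator G x y" "x \<otimes> y" "y \<otimes> x"]
  by (simp add: commutator_def m_assoc inv_mult_group)

text \<open>Cancelling \<open>y \<otimes> x\<close> determines \<open>c\<close>. Commutator
  identities can thus be proved by reordering products, without unfolding the four-fold
  product.\<close>

lemma commutator_eqI:
  assumes "x \<in> carrier G" "y \<in> carrier G" "c \<in> carrier G" "x \<otimes> y = c \<otimes> (y \<otimes> x)"
  shows "commutator G x y = c"
  using assms mult_eq_commutator_mult[of x y] right_cancel[of "y \<otimes> x" "commutator G x y" c]
  by simp

lemma commutator_eq_one_iff: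
  "x \<in> carrier G \<Longrightarrow> y \<in> carrier G \<Longrightarrow> commutator G x y = \<one> \<longleftrightarrow> x \<otimes> y = y \<otimes> x"
  by (metis commutator_eqI mult_eq_commutator_mult l_one m_closed one_closed)

lemma inv_mult_cancel [simp]:
  assumes "x \<in> carrier G" "y \<in> carrier G"
  shows "inv x \<otimes> (x \<otimes> y) = y" "x \<otimes> (inv x \<otimes> y) = y"
  using assms by (simp_all flip: m_assoc)

lemma group_center_closed: "z \<in> group_center G \<Longrightarrow> z \<in> carrier G"
  by (simp add: group_center_def)

lemma group_center_commute:
  "z \<in> group_center G \<Longrightarrow> x \<in> carrier G \<Longrightarrow> z \<otimes> x = x \<otimes> z"
  by (simp add: group_center_def)

lemma subgroup_group_center: "subgroup (group_center G) G"
proof (rule subgroupI)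
  have "\<one> \<in> group_center G" by (simp add: group_center_def)
  then show "group_center G \<noteq> {}" by blast
next
  fix z assume z: "z \<in> group_center G"
  have "inv z \<otimes> x = x \<otimes> inv z" if x: "x \<in> carrier G" for x
  proof -
    have "inv (inv x \<otimes> z) = inv (z \<otimes> inv x)"
      by (simp only: group_center_commute[OF z inv_closed[OF x]])
    then show ?thesis using x group_center_closed[OF z] by (simp add: inv_mult_group)
  qed
  then show "inv z \<in> group_center G"
    using group_center_closed[OF z] by (simp add: group_center_def)
next
  fix y z assume y: "y \<in> group_center G" and z: "z \<in> group_center G"
  have [simp]: "y \<in> carrier G" "z \<in> carrier G" using y z by (auto dest: group_center_closed)
  have "y \<otimes> z \<otimes> x = x \<otimes> (y \<otimes> z)" if x [simp]: "x \<in> carrier G" for x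
  proof -
    have "y \<otimes> z \<otimes> x = y \<otimes> x \<otimes> z" using group_center_commute[OF z x] by (simp add: m_assoc)
    then show ?thesis using group_center_commute[OF y x] by (simp add: m_assoc)
  qed
  then show "y \<otimes> z \<in> group_center G" by (simp add: group_center_def)
qed (auto dest: group_center_closed)

lemma normal_group_center: "group_center G \<lhd> G"
proof (rule normal_invI[OF subgroup_group_center])
  fix x z assume x: "x \<in> carrier G" and z: "z \<in> group_center G"
  have "x \<otimes> z \<otimes> inv x = z"
    using x z group_center_commute[OF z x, symmetric] group_center_closed[OF z] by (simp add: m_assoc)
  then show "x \<otimes> z \<otimes> inv x \<in> group_center G" using z by simp
qed

end

section \<open>Class-two groups with centre of prime order\<close>

text \<open>\<open>comm_center\<close> and \<open>pow_center\<close> restate on elements that the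
  quotient by the centre is elementary abelian, so computations stay inside
  \<open>G\<close>.\<close>

locale extraspecial_group = group G for G (structure) +
  fixes p :: nat
  assumes fin: "finite (carrier G)"
    and prime: "prime p" and odd: "odd p"
    and card_center: "card (group_center G) = p"
    and comm_center: "x \<in> carrier G \<Longrightarrow> y \<in> carrier G \<Longrightarrow> commutator G x y \<in> group_center G"
    and pow_center: "x \<in> carrier G \<Longrightarrow> x [^] p \<in> group_center G"
begin

abbreviation "Z \<equiv> group_center G"
abbreviation "comm \<equiv> commutator G"

lemma Z_closed [simp]: "z \<in> Z \<Longrightarrow> z \<in> carrier G"
  by (simp add: group_center_def)

lemma Z_mult [simp]: "y \<in> Z \<Longrightarrow> z \<in> Z \<Longrightarrow> y \<otimes> z \<in> Z"
  and Z_inv [simp]: "z \<in> Z \<Longrightarrow> inv z \<in> Z"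
  and Z_one [simp]: "\<one> \<in> Z"
  using subgroup_group_center by (auto simp: subgroup_def)

lemma Z_pow [simp]: "z \<in> Z \<Longrightarrow> z [^] (n::nat) \<in> Z"
  by (induction n) auto

lemma Z_commute: "z \<in> Z \<Longrightarrow> x \<in> carrier G \<Longrightarrow> z \<otimes> x = x \<otimes> z"
  by (rule group_center_commute)

lemma Z_left_commute:
  "z \<in> Z \<Longrightarrow> x \<in> carrier G \<Longrightarrow> y \<in> carrier G \<Longrightarrow> x \<otimes> (z \<otimes> y) = z \<otimes> (x \<otimes> y)"
  using m_assoc[of x z y] m_assoc[of z x y] Z_commute[of z x] by simp

text \<open>\<open>comm y z\<close> is central and can be pulled in front of \<open>x\<close>. With
  the version for the second argument, the commutator becomes a bilinear map into
  \<open>Z\<close>.\<close>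

lemma comm_mult_left:
  assumes [simp]: "x \<in> carrier G" "y \<in> carrier G" "z \<in> carrier G"
  shows "comm (x \<otimes> y) z = comm x z \<otimes> comm y z"
proof (rule commutator_eqI)
  have "x \<otimes> y \<otimes> z = x \<otimes> (comm y z \<otimes> (z \<otimes> y))"
    using mult_eq_commutator_mult[of y z] by (simp add: m_assoc)
  also have "\<dots> = comm y z \<otimes> (x \<otimes> z \<otimes> y)"
    by (subst Z_left_commute) (simp_all add: comm_center m_assoc)
  also have "\<dots> = comm y z \<otimes> comm x z \<otimes> (z \<otimes> (x \<otimes> y))"
    by (subst mult_eq_commutator_mult[of x z]) (simp_all add: m_assoc)
  finally show "x \<otimes> y \<otimes> z = comm x z \<otimes> comm y z \<otimes> (z \<otimes> (x \<otimes> y))"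
    by (simp add: Z_commute comm_center)
qed simp_all

lemma comm_inverse:
  assumes [simp]: "x \<in> carrier G" "y \<in> carrier G"
  shows "comm y x = inv (comm x y)"
proof -
  have "y \<otimes> x = inv (comm x y) \<otimes> (x \<otimes> y)"
    by (subst mult_eq_commutator_mult[of x y]) (simp_all flip: m_assoc)
  then show ?thesis by (intro commutator_eqI) simp_all
qed

lemma comm_mult_right:
  assumes [simp]: "x \<in> carrier G" "y \<in> carrier G" "z \<in> carrier G"
  shows "comm x (y \<otimes> z) = comm x y \<otimes> comm x z"
proof -
  have "comm x (y \<otimes> z) = inv (comm y x \<otimes> comm z x)"
    by (simp add: comm_inverse[of "y \<otimes> z" x] comm_mult_left)
  also have "\<dots> = comm x z \<otimes> comm x y"
    by (simp add: inv_mult_group comm_inverse[of y x] comm_inverse[of z x])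
  finally show ?thesis by (simp add: Z_commute comm_center)
qed

lemma comm_Z_left [simp]: "z \<in> Z \<Longrightarrow> x \<in> carrier G \<Longrightarrow> comm z x = \<one>"
  and comm_Z_right [simp]: "z \<in> Z \<Longrightarrow> x \<in> carrier G \<Longrightarrow> comm x z = \<one>"
  and comm_self [simp]: "x \<in> carrier G \<Longrightarrow> comm x x = \<one>"
  by (simp_all add: commutator_eq_one_iff Z_commute)

lemma comm_inv_left:
  assumes [simp]: "x \<in> carrier G" "y \<in> carrier G"
  shows "comm (inv x) y = inv (comm x y)"
  using comm_mult_left[of "inv x" x y] inv_equality[of "comm (inv x) y" "comm x y"] by simp

lemma comm_pow_left:
  assumes [simp]: "x \<in> carrier G" "y \<in> carrier G"
  shows "comm (x [^] (n::nat)) y = comm x y [^] n"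
  by (induction n) (simp_all add: comm_mult_left)

lemma Z_pow_p: assumes "z \<in> Z" shows "z [^] p = \<one>"
proof -
  interpret Z: group "G\<lparr>carrier := Z\<rparr>"
    by (rule subgroup.subgroup_is_group[OF subgroup_group_center is_group])
  have "z [^]\<^bsub>G\<lparr>carrier := Z\<rparr>\<^esub> order (G\<lparr>carrier := Z\<rparr>) = \<one>\<^bsub>G\<lparr>carrier := Z\<rparr>\<^esub>"
    by (rule Z.pow_order_eq_1) (use assms in simp)
  then show ?thesis
    by (simp add: order_def card_center nat_pow_def)
qed

text \<open>\<open>Z\<close> has prime order: the powers of \<open>z\<close> below its order are
  \<open>p\<close> distinct elements of \<open>Z\<close>, hence all of them.\<close>

lemma Z_generated:
  assumes "z \<in> Z" "z \<noteq> \<one>" "w \<in> Z"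
  shows "\<exists>i::nat. w = z [^] i"
proof -
  have zG: "z \<in> carrier G" using assms by simp
  have "ord z dvd p" using Z_pow_p[OF assms(1)] pow_eq_id[OF zG] by blast
  moreover have "ord z \<noteq> 1" using ord_eq_1[OF zG] assms by simp
  ultimately have ord: "ord z = p" using prime by (auto simp: prime_nat_iff)
  have "inj_on (\<lambda>i. z [^] i) {0..ord z - 1}" by (rule ord_inj[OF zG])
  then have "card ((\<lambda>i. z [^] i) ` {0..ord z - 1}) = p"
    using ord prime_gt_0_nat[OF prime] by (simp add: card_image)
  moreover have "(\<lambda>i. z [^] i) ` {0..ord z - 1} \<subseteq> Z" using assms by auto
  moreover have "finite Z" using fin by (rule finite_subset[rotated]) auto
  ultimately have "(\<lambda>i. z [^] i) ` {0..ord z - 1} = Z"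
    using card_center by (intro card_subset_eq) auto
  then show ?thesis using assms by blast
qed

section \<open>Powers of products, with odd \<open>p\<close>\<close>

text \<open>Moving \<open>y [^] n\<close> past the next \<open>x\<close> costs the central factor
  \<open>comm y x [^] n\<close>; these costs accumulate to the binomial coefficient of
  \<open>n\<close> over 2.\<close>

lemma pow_mult_class_two:
  assumes [simp]: "x \<in> carrier G" "y \<in> carrier G"
  shows "(x \<otimes> y) [^] (n::nat) = comm y x [^] (\<Sum>i<n. i) \<otimes> (x [^] n \<otimes> y [^] n)"
proof (induction n)
  case (Suc n)
  let ?c = "comm y x"
  have c: "?c \<in> Z" by (simp add: comm_center)
  have "(x \<otimes> y) [^] Suc n = ?c [^] (\<Sum>i<n. i) \<otimes> (x [^] n \<otimes> ((y [^] n \<otimes> x) \<otimes> y))"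
    using Suc by (simp add: m_assoc)
  also have "y [^] n \<otimes> x = ?c [^] n \<otimes> (x \<otimes> y [^] n)"
    using mult_eq_commutator_mult[of "y [^] n" x] by (simp add: comm_pow_left)
  also have "x [^] n \<otimes> (?c [^] n \<otimes> (x \<otimes> y [^] n) \<otimes> y) = ?c [^] n \<otimes> (x [^] Suc n \<otimes> y [^] Suc n)"
    using c by (subst m_assoc, simp_all, subst Z_left_commute) (simp_all add: m_assoc nat_pow_Suc2[of x])
  also have "?c [^] (\<Sum>i<n. i) \<otimes> (?c [^] n \<otimes> (x [^] Suc n \<otimes> y [^] Suc n)) =
      ?c [^] (\<Sum>i<n. i) \<otimes> ?c [^] n \<otimes> (x [^] Suc n \<otimes> y [^] Suc n)"
    using c by (intro m_assoc[symmetric]) auto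
  also have "?c [^] (\<Sum>i<n. i) \<otimes> ?c [^] n = ?c [^] (\<Sum>i<Suc n. i)"
    using c by (simp add: nat_pow_mult)
  finally show ?case .
qed simp

text \<open>For \<open>p = 2 * k + 1\<close> the exponent of the correcting commutator is
  \<open>p * k\<close>, and \<open>Z\<close> has exponent \<open>p\<close>.\<close>

lemma pow_p_mult:
  assumes "x \<in> carrier G" "y \<in> carrier G"
  shows "(x \<otimes> y) [^] p = x [^] p \<otimes> y [^] p"
proof -
  obtain k where "p = 2 * k + 1" using odd by (rule oddE)
  then have k: "p = Suc (2 * k)" by simp
  have "(\<Sum>i<Suc (2 * k). i) = Suc (2 * k) * k" by (induction k) simp_all
  then have "(\<Sum>i<p. i) = p * k" by (simp only: k)
  then have "comm y x [^] (\<Sum>i<p. i) = \<one>"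
    using Z_pow_p[OF comm_center, of y x] assms by (simp flip: nat_pow_pow)
  then show ?thesis using pow_mult_class_two[OF assms, of p] assms by simp
qed

text \<open>A group of odd order has no involutions. This keeps the squared commutator factor
  nontrivial in the case \<open>g \<in> C\<close> of \<open>exists_balanced_map\<close>.\<close>

lemma Z_eq_one_if_square:
  assumes z: "z \<in> Z" and sq: "z \<otimes> z = \<one>"
  shows "z = \<one>"
proof -
  obtain k where k: "p = 2 * k + 1" using odd by (rule oddE)
  have "z [^] (2::nat) = \<one>" using z sq by (simp add: numeral_2_eq_2)
  then have "z [^] (2 * k) = \<one>" using z by (simp flip: nat_pow_pow)
  then show ?thesis using Z_pow_p[OF z] z by (simp add: k)
qed

lemma exists_noncommuting:
  assumes "g \<in> carrier G" "g \<notin> Z"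
  shows "\<exists>x\<in>carrier G. comm x g \<noteq> \<one>"
proof -
  have "\<exists>x\<in>carrier G. g \<otimes> x \<noteq> x \<otimes> g"
    using assms unfolding group_center_def by blast
  then obtain x where "x \<in> carrier G" "x \<otimes> g \<noteq> g \<otimes> x" by metis
  then show ?thesis using assms(1) commutator_eq_one_iff[of x g] by blast
qed

section \<open>Equidistribution on the centre\<close>

text \<open>\<open>\<pi>\<close> injects the fibre of \<open>\<rho>\<close> over \<open>v\<close>
  into the fibre over \<open>v \<otimes> \<zeta>\<close>. Since \<open>\<zeta>\<close> generates
  \<open>Z\<close>, any fibre is at most as large as any other, so all have equal size.\<close>

lemma card_fibre:
  assumes fS: "finite S" and \<pi>: "inj_on \<pi> S" "\<pi> ` S \<subseteq> S"
    and \<rho>: "\<And>x. x \<in> S \<Longrightarrow> \<rho> x \<in> Z"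
    and \<zeta>: "\<zeta> \<in> Z" "\<zeta> \<noteq> \<one>"
    and shift: "\<And>x. x \<in> S \<Longrightarrow> \<rho> (\<pi> x) = \<rho> x \<otimes> \<zeta>"
    and w: "w \<in> Z"
  shows "p * card {x \<in> S. \<rho> x = w} = card S"
proof -
  let ?N = "\<lambda>v. card {x \<in> S. \<rho> x = v}"
  have step: "?N v \<le> ?N (v \<otimes> \<zeta>)" for v
  proof (rule card_inj_on_le)
    show "inj_on \<pi> {x \<in> S. \<rho> x = v}" using \<pi>(1) by (rule inj_on_subset) auto
    show "\<pi> ` {x \<in> S. \<rho> x = v} \<subseteq> {x \<in> S. \<rho> x = v \<otimes> \<zeta>}" using \<pi>(2) shift by auto
  qed (use fS in simp)
  have steps: "?N v \<le> ?N (v \<otimes> \<zeta> [^] i)" if "v \<in> Z" for v and i :: nat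
  proof (induction i)
    case (Suc i)
    then show ?case using step[of "v \<otimes> \<zeta> [^] i"] that \<zeta> by (simp add: m_assoc)
  qed (use that in simp)
  have le: "?N v \<le> ?N u" if v: "v \<in> Z" and u: "u \<in> Z" for u v
  proof -
    obtain i :: nat where i: "inv v \<otimes> u = \<zeta> [^] i"
      using Z_generated[of \<zeta> "inv v \<otimes> u"] \<zeta> u v by auto
    have "v \<otimes> \<zeta> [^] i = u" using u v by (simp flip: i m_assoc)
    then show ?thesis using steps[OF v, of i] by simp
  qed
  have fZ: "finite Z" using fin by (rule finite_subset[rotated]) auto
  have "card S = (\<Sum>v\<in>Z. ?N v)"
    using sum.group[OF fS fZ, of \<rho> "\<lambda>_. 1::nat"] \<rho> by (auto simp: image_subset_iff)
  also have "\<dots> = (\<Sum>v\<in>Z. ?N w)" by (intro sum.cong refl antisym le w)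
  finally show ?thesis using card_center by simp
qed

section \<open>Maximal split abelian subgroups\<close>

text \<open>\<open>A\<close> is elementary abelian and the product \<open>A Z\<close> is direct;
  directness makes the \<open>Z\<close>-coordinate in \<open>exists_equivariant_map\<close> well
  defined.\<close>

definition split_abelian :: "'a set \<Rightarrow> bool" where
  "split_abelian A \<longleftrightarrow> subgroup A G \<and> (\<forall>x\<in>A. \<forall>y\<in>A. comm x y = \<one>) \<and>
     (\<forall>x\<in>A. x [^] p = \<one>) \<and> A \<inter> Z = {\<one>}"

lemma exists_maximal_split_abelian:
  "\<exists>A. split_abelian A \<and> (\<forall>B. split_abelian B \<longrightarrow> A \<subseteq> B \<longrightarrow> A = B)"
proof -
  have "{A. split_abelian A} \<subseteq> Pow (carrier G)"
    by (auto simp: split_abelian_def dest: subgroup.mem_carrier)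
  then have "finite {A. split_abelian A}" using fin by (auto intro: finite_subset)
  moreover have "split_abelian {\<one>}"
    by (auto simp: split_abelian_def triv_subgroup)
  ultimately show ?thesis
    using finite_has_maximal[of "{A. split_abelian A}"] by blast
qed

text \<open>If \<open>x\<close> were outside \<open>A Z\<close>, adjoining it to \<open>A\<close>
  would give a larger split abelian subgroup. The delicate point is that the larger group still
  meets \<open>Z\<close> trivially.\<close>

lemma maximal_split_abelian_centralizer:
  assumes A: "split_abelian A" and max: "\<And>B. split_abelian B \<Longrightarrow> A \<subseteq> B \<Longrightarrow> A = B"
    and x: "x \<in> carrier G" and cx: "\<And>a. a \<in> A \<Longrightarrow> comm x a = \<one>" and xp: "x [^] p = \<one>"
  shows "\<exists>a\<in>A. \<exists>z\<in>Z. x = a \<otimes> z"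
proof (rule ccontr)
  assume contra: "\<not> ?thesis"
  have sA: "subgroup A G" using A by (simp add: split_abelian_def)
  interpret A: subgroup A G by (rule sA)
  \<comment> \<open>The subgroup generated by \<open>A\<close> and \<open>x\<close>; integer
    exponents make closure under inverses immediate.\<close>
  let ?B = "{a \<otimes> x [^] i | a i::int. a \<in> A}"
  have BI: "a \<otimes> x [^] i \<in> ?B" if "a \<in> A" for a and i :: int
    using that by blast
  have xi: "x [^] i \<otimes> a = a \<otimes> x [^] i" if a: "a \<in> A" for a and i :: int
  proof -
    have "comm (x [^] (n::nat)) a = \<one>" for n
      using a x cx by (simp add: comm_pow_left)
    then have "comm (x [^] i) a = \<one>"
      using a x by (cases i) (simp_all add: int_pow_int int_pow_neg_int comm_inv_left cx comm_mult_left del: of_nat_Suc)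
    then show ?thesis using a x by (simp add: commutator_eq_one_iff)
  qed
  have mul: "a \<otimes> x [^] i \<otimes> (b \<otimes> x [^] j) = a \<otimes> b \<otimes> x [^] (i + j)"
    if "a \<in> A" "b \<in> A" for a b and i j :: int
  proof -
    have "a \<otimes> x [^] i \<otimes> (b \<otimes> x [^] j) = a \<otimes> (x [^] i \<otimes> b) \<otimes> x [^] j"
      using that x by (simp add: m_assoc)
    then show ?thesis using that x by (simp add: xi m_assoc int_pow_mult)
  qed
  have pow: "(a \<otimes> x [^] i) [^] (n::nat) = a [^] n \<otimes> x [^] (i * int n)" if "a \<in> A" for a n and i :: int
    using that x by (subst pow_mult_distrib) (simp_all add: xi int_pow_pow flip: int_pow_int)
  have ab: "a \<otimes> b = b \<otimes> a" if "a \<in> A" "b \<in> A" for a b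
    using A that by (simp add: split_abelian_def commutator_eq_one_iff)
  have "split_abelian ?B"
    unfolding split_abelian_def
  proof (intro conjI ballI)
    show "subgroup ?B G"
    proof (rule subgroupI)
      show "?B \<subseteq> carrier G" using x by auto
      show "?B \<noteq> {}" using BI[OF A.one_closed] by (metis (no_types) empty_iff)
    next
      fix u assume "u \<in> ?B"
      then obtain a i where u: "u = a \<otimes> x [^] (i::int)" "a \<in> A" by blast
      have "inv u = inv a \<otimes> x [^] (- i)"
        using u x xi[of "inv a" "- i"] by (simp add: inv_mult_group int_pow_neg)
      then show "inv u \<in> ?B" using BI[of "inv a" "- i"] u by simp
    next
      fix u v assume "u \<in> ?B" "v \<in> ?B"
      then obtain a i b j where "u = a \<otimes> x [^] (i::int)" "a \<in> A" "v = b \<otimes> x [^] (j::int)" "b \<in> A"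
        by blast
      then show "u \<otimes> v \<in> ?B" using mul BI[of "a \<otimes> b" "i + j"] by simp
    qed
  next
    fix u v assume "u \<in> ?B" "v \<in> ?B"
    then obtain a i b j where uv: "u = a \<otimes> x [^] (i::int)" "a \<in> A" "v = b \<otimes> x [^] (j::int)" "b \<in> A"
      by blast
    then have "u \<otimes> v = v \<otimes> u" using mul ab by (simp add: add.commute)
    then show "comm u v = \<one>" using uv x by (simp add: commutator_eq_one_iff)
  next
    fix u assume "u \<in> ?B"
    then obtain a i where u: "u = a \<otimes> x [^] (i::int)" "a \<in> A" by blast
    have "x [^] (i * int p) = \<one>"
      using x xp by (simp add: mult.commute[of i] int_pow_int flip: int_pow_pow)
    then show "u [^] p = \<one>" using u A by (simp add: pow split_abelian_def)
  next
    have BZ: "u = \<one>" if uB: "u \<in> ?B" and uZ: "u \<in> Z" for u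
    proof -
      obtain a i where u: "u = a \<otimes> x [^] (i::int)" "a \<in> A" using uB by blast
      show ?thesis
      proof (cases "int p dvd i")
        case True
        then obtain j where "i = int p * j" by blast
        then have "x [^] i = \<one>" using x xp by (simp add: int_pow_int flip: int_pow_pow)
        then have "u = a" using u by simp
        then show ?thesis using A u uZ by (auto simp: split_abelian_def)
      next
        case False
        then have "coprime i (int p)"
          using prime by (simp add: coprime_commute[of i] prime_imp_coprime)
        then obtain j k where jk: "j * i + k * int p = 1"
          by (metis bezout_int coprime_imp_gcd_eq_1)
        \<comment> \<open>Bezout gives an inverse \<open>j\<close> of \<open>i\<close> modulo
          \<open>p\<close>. Its natural representative \<open>n\<close> yields
          \<open>u [^] n = a [^] n \<otimes> x\<close>, which exhibits \<open>x\<close> in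
          \<open>A Z\<close>, against the assumption.\<close>
        define n where "n = nat (j mod int p)"
        have n: "int n = j mod int p" using prime_gt_0_nat[OF prime] by (simp add: n_def)
        have "i * int n = 1 + int p * (- k - i * (j div int p))"
          using jk unfolding n by (simp add: algebra_simps minus_mult_div_eq_mod[symmetric])
        then have "x [^] (i * int n) = x"
          using x xp by (simp add: int_pow_mult int_pow_int flip: int_pow_pow)
        then have "u [^] n = a [^] n \<otimes> x" using u by (simp add: pow)
        then have "x = inv (a [^] n) \<otimes> u [^] n"
          using u x by (simp add: inv_solve_left)
        moreover have "inv (a [^] n) \<in> A"
          using u by (induction n) (simp_all add: inv_mult_group)
        ultimately show ?thesis using contra Z_pow[OF uZ, of n] by blast
      qed
    qed
    have "\<one> \<in> ?B" using BI[OF A.one_closed, of 0] by simp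
    then have "\<one> \<in> ?B \<inter> Z" using Z_one by (rule IntI)
    moreover have "?B \<inter> Z \<subseteq> {\<one>}"
    proof
      fix u assume "u \<in> ?B \<inter> Z"
      then show "u \<in> {\<one>}" using BZ[of u] by (simp only: Int_iff singleton_iff)
    qed
    ultimately show "?B \<inter> Z = {\<one>}" by (intro equalityI) (simp_all only: insert_subset empty_subsetI)
  qed
  moreover have "A \<subseteq> ?B"
  proof
    fix a assume "a \<in> A"
    then show "a \<in> ?B" using BI[of a 0] by simp
  qed
  ultimately have "A = ?B" by (rule max)
  moreover have "x \<in> ?B" using BI[OF A.one_closed, of 1] x by simp
  ultimately have "x \<in> A" by simp
  \<comment> \<open>\<open>x\<close> itself is a product of an element of \<open>A\<close> and the
    central element \<open>\<one>\<close>.\<close>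
  then show False using contra x by (metis Z_one r_one)
qed

section \<open>An equivariant map onto the centre coordinate\<close>

text \<open>Fix a representative \<open>s x\<close> of each coset of \<open>A Z\<close> and let
  \<open>f\<close> read off the factor \<open>z\<close> in
  \<open>x = s x \<otimes> a \<otimes> z\<close>.\<close>

lemma exists_equivariant_map:
  assumes A: "subgroup A G" and AZ: "A \<inter> Z = {\<one>}"
  shows "\<exists>f. (\<forall>x\<in>carrier G. f x \<in> Z) \<and> (\<forall>x\<in>carrier G. \<forall>z\<in>Z. f (x \<otimes> z) = f x \<otimes> z) \<and>
    (\<forall>x\<in>carrier G. \<forall>a\<in>A. f (x \<otimes> a) = f x)"
proof -
  interpret A: subgroup A G by (rule A)
  \<comment> \<open>\<open>R x\<close> is the coset of \<open>A Z\<close> containing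
    \<open>x\<close>. As \<open>s\<close> chooses from this set alone, it is constant on
    cosets.\<close>
  define R where "R x = {y \<in> carrier G. \<exists>a\<in>A. \<exists>z\<in>Z. x = y \<otimes> a \<otimes> z}" for x
  define s where "s x = (SOME y. y \<in> R x)" for x
  define f where "f x = (THE z. z \<in> Z \<and> (\<exists>a\<in>A. x = s x \<otimes> a \<otimes> z))" for x
  have move: "y \<otimes> a \<otimes> z \<otimes> b \<otimes> w = y \<otimes> (a \<otimes> b) \<otimes> (z \<otimes> w)"
    if "y \<in> carrier G" "a \<in> A" "b \<in> A" "z \<in> Z" "w \<in> Z" for y a b z w
  proof -
    have "y \<otimes> a \<otimes> z \<otimes> b \<otimes> w = y \<otimes> a \<otimes> (z \<otimes> b) \<otimes> w" using that by (simp add: m_assoc)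
    also have "z \<otimes> b = b \<otimes> z" using that by (simp add: Z_commute)
    finally show ?thesis using that by (simp add: m_assoc)
  qed
  have R_le: "R x \<subseteq> R (x \<otimes> b \<otimes> w)" if b: "b \<in> A" and w: "w \<in> Z" for x b w
  proof
    fix y assume "y \<in> R x"
    then obtain a z where yaz: "y \<in> carrier G" "a \<in> A" "z \<in> Z" "x = y \<otimes> a \<otimes> z"
      by (auto simp: R_def)
    then have "x \<otimes> b \<otimes> w = y \<otimes> (a \<otimes> b) \<otimes> (z \<otimes> w)" using b w move by simp
    moreover have "a \<otimes> b \<in> A" "z \<otimes> w \<in> Z" using yaz b w by simp_all
    ultimately show "y \<in> R (x \<otimes> b \<otimes> w)" using yaz(1) unfolding R_def by blast
  qed
  have s_eq: "s (x \<otimes> b \<otimes> w) = s x" if "x \<in> carrier G" "b \<in> A" "w \<in> Z" for x b w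
  proof -
    have "x \<otimes> b \<otimes> w \<otimes> inv b \<otimes> inv w = x"
      using move[of x b "inv b" w "inv w"] that by simp
    then have "R (x \<otimes> b \<otimes> w) \<subseteq> R x"
      using R_le[of "inv b" "inv w" "x \<otimes> b \<otimes> w"] that by simp
    then have "R (x \<otimes> b \<otimes> w) = R x" using R_le that by blast
    then show ?thesis by (simp add: s_def)
  qed
  have s: "s x \<in> R x" if "x \<in> carrier G" for x
  proof -
    have "x = x \<otimes> \<one> \<otimes> \<one>" using that by simp
    then have "x \<in> R x" using that A.one_closed Z_one unfolding R_def by blast
    then show ?thesis unfolding s_def by (rule someI)
  qed
  have f_eq: "f x = z" if xs: "s x \<in> carrier G" and z: "z \<in> Z" and a: "a \<in> A" and x: "x = s x \<otimes> a \<otimes> z"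
    for x a z
    unfolding f_def
  proof (rule the_equality)
    show "z \<in> Z \<and> (\<exists>a\<in>A. x = s x \<otimes> a \<otimes> z)" using z a x by blast
  next
    fix w assume "w \<in> Z \<and> (\<exists>a\<in>A. x = s x \<otimes> a \<otimes> w)"
    then obtain b where w: "w \<in> Z" and b: "b \<in> A" and x': "x = s x \<otimes> b \<otimes> w" by blast
    have "s x \<otimes> (a \<otimes> z) = s x \<otimes> (b \<otimes> w)"
      using x x' xs z w a b by (simp add: m_assoc)
    then have ab: "a \<otimes> z = b \<otimes> w" using xs z w a b by simp
    have "inv b \<otimes> a = inv b \<otimes> (a \<otimes> z) \<otimes> inv z" using z a b by (simp add: m_assoc)
    also have "\<dots> = w \<otimes> inv z" unfolding ab using z w b by (simp flip: m_assoc)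
    finally have e: "w \<otimes> inv z = inv b \<otimes> a" by simp
    \<comment> \<open>Two factorizations of \<open>x\<close> differ by an element that lies in both
      \<open>A\<close> and \<open>Z\<close>.\<close>
    have "w \<otimes> inv z \<in> A \<inter> Z"
    proof
      show "w \<otimes> inv z \<in> A" unfolding e using a b by simp
    qed (use z w in simp)
    then have "w \<otimes> inv z = \<one>" using AZ by simp
    then show "w = z" using z w by (metis Z_closed inv_closed inv_equality inv_inv)
  qed
  have f: "f x \<in> Z \<and> f (x \<otimes> b \<otimes> w) = f x \<otimes> w"
    if x: "x \<in> carrier G" and b: "b \<in> A" and w: "w \<in> Z" for x b w
  proof -
    obtain a z where *: "s x \<in> carrier G" "a \<in> A" "z \<in> Z" "x = s x \<otimes> a \<otimes> z"
      using s[OF x] by (auto simp: R_def)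
    have "f x = z" using * by (intro f_eq)
    moreover have "x \<otimes> b \<otimes> w = s x \<otimes> (a \<otimes> b) \<otimes> (z \<otimes> w)"
      using * b w by (subst *(4)) (rule move)
    then have "f (x \<otimes> b \<otimes> w) = z \<otimes> w"
      using *(1-3) b w f_eq[of "x \<otimes> b \<otimes> w" "z \<otimes> w" "a \<otimes> b", unfolded s_eq[OF x b w]]
      by (metis A.m_closed Z_mult)
    ultimately show ?thesis using * by simp
  qed
  show ?thesis
  proof (intro exI[of _ f] conjI ballI)
    fix x assume x: "x \<in> carrier G"
    show "f x \<in> Z" using f[OF x, of \<one> \<one>] by simp
    show "f (x \<otimes> z) = f x \<otimes> z" if "z \<in> Z" for z using f[OF x, of \<one> z] x that by simp
    show "f (x \<otimes> a) = f x" if "a \<in> A" for a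
      using f[OF x that Z_one] x that by simp
  qed
qed

section \<open>The balanced map\<close>

lemma Z_cancel:
  assumes "a \<in> Z" "b \<in> Z" "c \<in> Z" "d \<in> Z"
  shows "a \<otimes> inv (c \<otimes> d) \<otimes> inv (b \<otimes> inv d) = a \<otimes> inv b \<otimes> inv c"
proof -
  have "a \<otimes> inv (c \<otimes> d) \<otimes> inv (b \<otimes> inv d) = a \<otimes> (inv d \<otimes> inv c) \<otimes> (d \<otimes> inv b)"
    using assms by (simp add: inv_mult_group)
  also have "\<dots> = a \<otimes> (inv d \<otimes> (inv c \<otimes> d)) \<otimes> inv b" using assms by (simp add: m_assoc)
  also have "inv c \<otimes> d = d \<otimes> inv c" using assms by (simp add: Z_commute)
  also have "a \<otimes> (inv d \<otimes> (d \<otimes> inv c)) \<otimes> inv b = a \<otimes> (inv c \<otimes> inv b)"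
    using assms by (simp add: m_assoc)
  also have "inv c \<otimes> inv b = inv b \<otimes> inv c" using assms by (simp add: Z_commute)
  finally show ?thesis using assms by (simp add: m_assoc)
qed

text \<open>Arithmetic in the abelian group \<open>Z\<close>: the effect on \<open>ratio\<close>
  below when the commutator \<open>c\<close> acquires a factor \<open>b\<close>.\<close>

lemma Z_square_inv:
  assumes "a \<in> Z" "b \<in> Z" "c \<in> Z"
  shows "a \<otimes> inv (b \<otimes> c) \<otimes> inv (b \<otimes> c) = a \<otimes> inv c \<otimes> inv c \<otimes> (inv b \<otimes> inv b)"
proof -
  have "inv (b \<otimes> c) \<otimes> inv (b \<otimes> c) = inv c \<otimes> (inv b \<otimes> inv c) \<otimes> inv b"
    using assms by (simp add: inv_mult_group m_assoc)
  also have "inv b \<otimes> inv c = inv c \<otimes> inv b" using assms by (simp add: Z_commute)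
  finally show ?thesis using assms by (simp add: m_assoc)
qed

text \<open>The last conjunct supplies \<open>\<pi>\<close>, \<open>\<zeta>\<close> and the
  \<open>shift\<close> equation that \<open>card_fibre\<close> needs for the ratio of
  \<open>F (g \<otimes> x)\<close> to \<open>F x\<close> on the whole group.\<close>

lemma exists_balanced_map:
  "\<exists>F. (\<forall>x\<in>carrier G. F x \<in> Z) \<and> (\<forall>x\<in>carrier G. \<forall>z\<in>Z. F (x \<otimes> z) = F x \<otimes> z) \<and>
    (\<forall>g\<in>carrier G - Z. \<exists>\<pi> \<zeta>. inj_on \<pi> (carrier G) \<and> \<pi> ` carrier G \<subseteq> carrier G \<and>
       \<zeta> \<in> Z \<and> \<zeta> \<noteq> \<one> \<and>
       (\<forall>x\<in>carrier G. F (g \<otimes> \<pi> x) \<otimes> inv (F (\<pi> x)) = F (g \<otimes> x) \<otimes> inv (F x) \<otimes> \<zeta>))"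
proof -
  obtain A where A: "split_abelian A" and max: "\<And>B. split_abelian B \<Longrightarrow> A \<subseteq> B \<Longrightarrow> A = B"
    using exists_maximal_split_abelian by blast
  have sA: "subgroup A G" and AZ: "A \<inter> Z = {\<one>}" using A by (auto simp: split_abelian_def)
  interpret A: subgroup A G by (rule sA)
  obtain f where fZ: "\<And>x. x \<in> carrier G \<Longrightarrow> f x \<in> Z"
    and fz: "\<And>x z. x \<in> carrier G \<Longrightarrow> z \<in> Z \<Longrightarrow> f (x \<otimes> z) = f x \<otimes> z"
    and fa: "\<And>x a. x \<in> carrier G \<Longrightarrow> a \<in> A \<Longrightarrow> f (x \<otimes> a) = f x"
    using exists_equivariant_map[OF sA AZ] by blast
  define C where "C = {x \<in> carrier G. \<forall>a\<in>A. comm x a = \<one>}"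
  have CA: "comm x a = \<one>" if "x \<in> C" "a \<in> A" for x a using that by (simp add: C_def)
  have C_mult: "x \<otimes> y \<in> C" if "x \<in> C" "y \<in> C" for x y
    using that by (simp add: C_def comm_mult_left)
  have C_inv: "inv x \<in> C" if "x \<in> C" for x
    using that by (simp add: C_def comm_inv_left)
  have ZC: "z \<in> C" if "z \<in> Z" for z using that by (simp add: C_def)
  have AC: "a \<in> C" if "a \<in> A" for a using that A by (simp add: C_def split_abelian_def)
  have CG [simp]: "x \<in> carrier G" if "x \<in> C" for x using that by (simp add: C_def)
  \<comment> \<open>Maximality of \<open>A\<close> puts \<open>x\<close> in \<open>A Z\<close>, and
    both factors commute with all of \<open>C\<close>.\<close>
  have torsion: "comm x y = \<one>" if x: "x \<in> C" and xp: "x [^] p = \<one>" and y: "y \<in> C" for x y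
  proof -
    obtain a z where az: "a \<in> A" "z \<in> Z" "x = a \<otimes> z"
      using maximal_split_abelian_centralizer[OF A max CG[OF x] CA[OF x] xp] by blast
    have "comm a y = inv (comm y a)" using az y by (intro comm_inverse) auto
    then show ?thesis using az y by (simp add: comm_mult_left CA)
  qed
  have C_pow: "x [^] (n::nat) \<in> C" if "x \<in> C" for x n
    using that ZC[OF Z_one] by (induction n) (auto intro: C_mult)
  \<comment> \<open>For \<open>x\<close> with \<open>x\<^sup>p \<noteq> 1\<close>, some \<open>y x\<^sup>-\<^sup>i\<close> has trivial \<open>p\<close>-th power, so it commutes with \<open>x\<close>.\<close>
  have C_abelian: "comm x y = \<one>" if x: "x \<in> C" and y: "y \<in> C" for x y
  proof (cases "x [^] p = \<one>")
    case True
    then show ?thesis using torsion x y by blast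
  next
    case False
    obtain i :: nat where i: "y [^] p = (x [^] p) [^] i"
      using Z_generated[OF pow_center False pow_center, of y] x y by auto
    define u where "u = y \<otimes> inv (x [^] i)"
    have uC: "u \<in> C" using x y by (simp add: u_def C_mult C_inv C_pow)
    have "u [^] p = y [^] p \<otimes> inv (x [^] i) [^] p" using x y by (simp add: u_def pow_p_mult)
    also have "inv (x [^] i) [^] p = inv ((x [^] p) [^] i)"
      using x by (simp add: nat_pow_inv nat_pow_pow mult.commute)
    finally have "u [^] p = \<one>" using x y i by simp
    then have ux: "comm u x = \<one>" using torsion uC x by blast
    have "y = u \<otimes> x [^] i" using x y by (simp add: u_def m_assoc)
    then have "comm y x = \<one>" using ux x uC by (simp add: comm_mult_left comm_pow_left)
    then show ?thesis using comm_inverse[of y x] x y by simp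
  qed
  define t where "t x = (SOME y. y \<in> carrier G \<and> inv x \<otimes> y \<in> C)" for x
  have t: "t x \<in> carrier G" "inv x \<otimes> t x \<in> C" if x: "x \<in> carrier G" for x
  proof -
    have "x \<in> carrier G \<and> inv x \<otimes> x \<in> C" using x ZC[OF Z_one] by simp
    then have "t x \<in> carrier G \<and> inv x \<otimes> t x \<in> C" unfolding t_def by (rule someI)
    then show "t x \<in> carrier G" "inv x \<otimes> t x \<in> C" by simp_all
  qed
  \<comment> \<open>\<open>x\<close> and \<open>y\<close> lie in one left coset of \<open>C\<close>,
    so the choice defining \<open>t\<close> is made from the same predicate.\<close>
  have t_eq: "t x = t y" if x: "x \<in> carrier G" and y: "y \<in> carrier G" and xy: "inv x \<otimes> y \<in> C" for x y
  proof -
    have "inv x \<otimes> w \<in> C \<longleftrightarrow> inv y \<otimes> w \<in> C" if w: "w \<in> carrier G" for w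
    proof
      have e1: "inv y \<otimes> w = inv (inv x \<otimes> y) \<otimes> (inv x \<otimes> w)"
        using x y w by (simp add: inv_mult_group m_assoc)
      show "inv y \<otimes> w \<in> C" if "inv x \<otimes> w \<in> C" unfolding e1 using that xy by (simp add: C_mult C_inv)
      have e2: "inv x \<otimes> w = (inv x \<otimes> y) \<otimes> (inv y \<otimes> w)"
        using x y w by (simp add: m_assoc)
      show "inv x \<otimes> w \<in> C" if "inv y \<otimes> w \<in> C" unfolding e2 using that xy by (simp add: C_mult)
    qed
    then show ?thesis unfolding t_def by (metis (no_types, lifting))
  qed
  define c where "c x = inv (t x) \<otimes> x" for x
  have c: "c x \<in> C" if x: "x \<in> carrier G" for x
  proof -
    have "c x = inv (inv x \<otimes> t x)" using x t[OF x] by (simp add: c_def inv_mult_group)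
    then show ?thesis using t[OF x] C_inv by simp
  qed
  have tc: "x = t x \<otimes> c x" if x: "x \<in> carrier G" for x
    using x t[OF x] by (simp add: c_def flip: m_assoc)
  \<comment> \<open>\<open>x\<close> and \<open>t x\<close> differ by the factor \<open>c x\<close>
    in \<open>C\<close>, invisible to any \<open>h\<close> that commutes with \<open>C\<close>. This
    serves for \<open>h\<close> in \<open>A\<close> and, as \<open>C\<close> is abelian, for
    \<open>h\<close> in \<open>C\<close>.\<close>
  have comm_t: "comm (t x) h = comm x h"
    if x: "x \<in> carrier G" and h: "h \<in> carrier G" "\<And>y. y \<in> C \<Longrightarrow> comm y h = \<one>" for x h
  proof -
    have "comm x h = comm (t x \<otimes> c x) h" using tc[OF x] by simp
    then show ?thesis using x h t[OF x] c[OF x] by (simp add: comm_mult_left)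
  qed
  \<comment> \<open>The factor \<open>f (c x)\<close> provides \<open>Z\<close>-equivariance. The
    commutator twist makes \<open>F\<close> sensitive to right translation by \<open>A\<close>,
    which \<open>f\<close> ignores.\<close>
  define F where "F x = f (c x) \<otimes> inv (comm (t x) x)" for x
  have FZ: "F x \<in> Z" if "x \<in> carrier G" for x
    using that t c by (simp add: F_def fZ comm_center)
  have t_C: "t (x \<otimes> y) = t x" if x: "x \<in> carrier G" and y: "y \<in> C" for x y
    using t_eq[of x "x \<otimes> y"] x y by (simp flip: m_assoc)
  have c_C: "c (x \<otimes> y) = c x \<otimes> y" if x: "x \<in> carrier G" and y: "y \<in> C" for x y
    using x y t[OF x] by (simp add: c_def t_C m_assoc)
  have Fz: "F (x \<otimes> z) = F x \<otimes> z" if x: "x \<in> carrier G" and z: "z \<in> Z" for x z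
  proof -
    have "F (x \<otimes> z) = f (c x) \<otimes> z \<otimes> inv (comm (t x) x)"
      using x z t[OF x] c[OF x] by (simp add: F_def t_C c_C ZC fz comm_mult_right)
    also have "\<dots> = f (c x) \<otimes> (z \<otimes> inv (comm (t x) x))"
      using x z t[OF x] c[OF x] fZ by (simp add: m_assoc)
    also have "z \<otimes> inv (comm (t x) x) = inv (comm (t x) x) \<otimes> z"
      using x z t[OF x] by (intro Z_commute) simp_all
    finally show ?thesis using x z t[OF x] c[OF x] fZ by (simp add: F_def m_assoc)
  qed
  have Fa: "F (x \<otimes> h) = F x \<otimes> inv (comm x h)" if x: "x \<in> carrier G" and h: "h \<in> A" for x h
  proof -
    have "comm (t x) h = comm x h" using x h by (intro comm_t CA) simp_all
    then have "F (x \<otimes> h) = f (c x) \<otimes> inv (comm (t x) x \<otimes> comm x h)"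
      using x h t[OF x] c[OF x] by (simp add: F_def t_C c_C AC fa comm_mult_right)
    also have "comm (t x) x \<otimes> comm x h = comm x h \<otimes> comm (t x) x"
      using x h t[OF x] by (intro Z_commute comm_center) simp_all
    finally show ?thesis using x h t[OF x] c[OF x] fZ by (simp add: F_def m_assoc inv_mult_group)
  qed
  have "\<exists>\<pi> \<zeta>. inj_on \<pi> (carrier G) \<and> \<pi> ` carrier G \<subseteq> carrier G \<and>
       \<zeta> \<in> Z \<and> \<zeta> \<noteq> \<one> \<and>
       (\<forall>x\<in>carrier G. F (g \<otimes> \<pi> x) \<otimes> inv (F (\<pi> x)) = F (g \<otimes> x) \<otimes> inv (F x) \<otimes> \<zeta>)"
    if g: "g \<in> carrier G" and gZ: "g \<notin> Z" for g
  proof (cases "g \<in> C")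
    case False
    then obtain h where h: "h \<in> A" and gh: "comm g h \<noteq> \<one>" using g unfolding C_def by blast
    show ?thesis
    proof (rule exI[of _ "\<lambda>x. x \<otimes> h"], rule exI[of _ "inv (comm g h)"], intro conjI ballI)
      show "inj_on (\<lambda>x. x \<otimes> h) (carrier G)" using h by (simp add: inj_on_def)
      show "(\<lambda>x. x \<otimes> h) ` carrier G \<subseteq> carrier G" using h by auto
      show "inv (comm g h) \<in> Z" using g h by (simp add: comm_center)
      show "inv (comm g h) \<noteq> \<one>" using g h gh by (metis A.mem_carrier commutator_closed inv_inv inv_one)
    next
      fix x assume x: "x \<in> carrier G"
      \<comment> \<open>By \<open>Fa\<close> the numerator gains the inverse of
        \<open>comm (g \<otimes> x) h\<close> and the denominator that of \<open>comm x h\<close>;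
        bilinearity leaves \<open>inv (comm g h)\<close>.\<close>
      have "F (g \<otimes> (x \<otimes> h)) \<otimes> inv (F (x \<otimes> h)) =
          F (g \<otimes> x) \<otimes> inv (comm g h \<otimes> comm x h) \<otimes> inv (F x \<otimes> inv (comm x h))"
        using x g h Fa[of "g \<otimes> x" h] by (simp add: Fa comm_mult_left m_assoc)
      also have "\<dots> = F (g \<otimes> x) \<otimes> inv (F x) \<otimes> inv (comm g h)"
        using x g h by (intro Z_cancel) (simp_all add: FZ comm_center)
      finally show "F (g \<otimes> (x \<otimes> h)) \<otimes> inv (F (x \<otimes> h)) = F (g \<otimes> x) \<otimes> inv (F x) \<otimes> inv (comm g h)" .
    qed
  next
    case gC: True
    obtain k where k: "k \<in> carrier G" and kg: "comm k g \<noteq> \<one>"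
      using exists_noncommuting[OF g gZ] by blast
    \<comment> \<open>The ratio depends on \<open>x\<close> only through \<open>c x\<close> and
      \<open>comm x g\<close>. One inverse commutator comes from moving \<open>g\<close> past
      \<open>t x\<close>, the other from the twist in \<open>F\<close>.\<close>
    have ratio: "F (g \<otimes> x) \<otimes> inv (F x) = f (g \<otimes> c x) \<otimes> inv (f (c x)) \<otimes> inv (comm x g) \<otimes> inv (comm x g)"
      if x: "x \<in> carrier G" for x
    proof -
      note [simp] = x g t(1)[OF x] c[OF x]
      \<comment> \<open>By bilinearity the contributions of \<open>inv x\<close> and
        \<open>x\<close> cancel, so \<open>g \<otimes> x\<close> stays in the left coset of
        \<open>x\<close>.\<close>
      have "inv x \<otimes> (g \<otimes> x) \<in> C"
        unfolding C_def using CA[OF gC] by (simp add: comm_mult_left comm_inv_left)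
      then have tg: "t (g \<otimes> x) = t x" by (intro t_eq[symmetric]) simp_all
      have ctg: "comm (t x) g = comm x g" using gC by (intro comm_t C_abelian) simp_all
      have "inv (t x) \<otimes> g = inv (comm x g) \<otimes> (g \<otimes> inv (t x))"
        using mult_eq_commutator_mult[of "inv (t x)" g] by (simp add: comm_inv_left ctg)
      then have "c (g \<otimes> x) = inv (comm x g) \<otimes> (g \<otimes> inv (t x)) \<otimes> x"
        by (simp add: c_def tg flip: m_assoc)
      also have "\<dots> = inv (comm x g) \<otimes> (g \<otimes> c x)" by (simp add: c_def m_assoc)
      also have "\<dots> = g \<otimes> c x \<otimes> inv (comm x g)" by (intro Z_commute) (simp_all add: comm_center)
      finally have "F (g \<otimes> x) = f (g \<otimes> c x) \<otimes> inv (comm x g) \<otimes> inv (comm x g \<otimes> comm (t x) x)"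
        by (simp add: F_def tg fz comm_center comm_mult_right ctg)
      then have "F (g \<otimes> x) \<otimes> inv (F x) = (f (g \<otimes> c x) \<otimes> inv (comm x g)) \<otimes>
          inv (comm x g \<otimes> comm (t x) x) \<otimes> inv (f (c x) \<otimes> inv (comm (t x) x))"
        by (simp add: F_def)
      also have "\<dots> = (f (g \<otimes> c x) \<otimes> inv (comm x g)) \<otimes> inv (f (c x)) \<otimes> inv (comm x g)"
        by (intro Z_cancel) (simp_all add: fZ comm_center)
      also have "\<dots> = f (g \<otimes> c x) \<otimes> (inv (comm x g) \<otimes> inv (f (c x))) \<otimes> inv (comm x g)"
        by (simp add: m_assoc fZ)
      also have "inv (comm x g) \<otimes> inv (f (c x)) = inv (f (c x)) \<otimes> inv (comm x g)"
        by (intro Z_commute) (simp_all add: comm_center fZ)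
      finally show ?thesis by (simp add: m_assoc fZ)
    qed
    \<comment> \<open>Left multiplication by \<open>k\<close> permutes the cosets of
      \<open>C\<close>; \<open>\<pi>\<close> follows it on representatives but keeps
      \<open>c x\<close>, so only the commutator in \<open>ratio\<close> changes.\<close>
    define \<pi> where "\<pi> x = t (k \<otimes> x) \<otimes> c x" for x
    have \<pi>G: "\<pi> x \<in> carrier G" if "x \<in> carrier G" for x
      using that t c k by (simp add: \<pi>_def)
    have t_t: "t (t x) = t x" if x: "x \<in> carrier G" for x
      using t[OF x] x by (intro t_eq[symmetric]) simp_all
    have t_\<pi>: "t (\<pi> x) = t (k \<otimes> x)" and c_\<pi>: "c (\<pi> x) = c x" if x: "x \<in> carrier G" for x
    proof -
      note [simp] = x t(1)[of "k \<otimes> x"] c[OF x] k t(1)[OF x]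
      show *: "t (\<pi> x) = t (k \<otimes> x)" by (simp add: \<pi>_def t_C t_t)
      then have "c (\<pi> x) = inv (t (k \<otimes> x)) \<otimes> \<pi> x" unfolding c_def by simp
      then show "c (\<pi> x) = c x" by (simp add: \<pi>_def flip: m_assoc)
    qed
    let ?w = "comm k g"
    have w: "?w \<in> Z" using k g by (simp add: comm_center)
    show ?thesis
    proof (rule exI[of _ \<pi>], rule exI[of _ "inv ?w \<otimes> inv ?w"], intro conjI ballI)
      show "inj_on \<pi> (carrier G)"
      proof (rule inj_onI)
        fix x y assume x: "x \<in> carrier G" and y: "y \<in> carrier G" and xy: "\<pi> x = \<pi> y"
        have cc: "c x = c y" using c_\<pi> x y xy by metis
        have tt: "t (k \<otimes> x) = t (k \<otimes> y)" using t_\<pi> x y xy by metis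
        \<comment> \<open>Equal representatives put \<open>k \<otimes> x\<close> and
          \<open>k \<otimes> y\<close> in one left coset of \<open>C\<close>; cancelling
          \<open>k\<close> does the same for \<open>x\<close> and \<open>y\<close>.\<close>
        have "inv (k \<otimes> x) \<otimes> t (k \<otimes> x) \<otimes> inv (inv (k \<otimes> y) \<otimes> t (k \<otimes> x)) \<in> C"
          using t(2)[of "k \<otimes> x"] t(2)[of "k \<otimes> y"] x y k tt by (simp add: C_mult C_inv)
        also have "inv (k \<otimes> x) \<otimes> t (k \<otimes> x) \<otimes> inv (inv (k \<otimes> y) \<otimes> t (k \<otimes> x)) = inv x \<otimes> y"
          using x y k t(1)[of "k \<otimes> x"] by (simp add: inv_mult_group m_assoc)
        finally have "t x = t y" using x y by (intro t_eq)
        then show "x = y" using tc x y cc by metis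
      qed
      show "\<pi> ` carrier G \<subseteq> carrier G" using \<pi>G by auto
      show "inv ?w \<otimes> inv ?w \<in> Z" using w by simp
      show "inv ?w \<otimes> inv ?w \<noteq> \<one>"
        using Z_eq_one_if_square[of "inv ?w"] w kg by (metis Z_closed Z_inv inv_inv inv_one)
    next
      fix x assume x: "x \<in> carrier G"
      \<comment> \<open>Commutation with \<open>g\<close> in the abelian group \<open>C\<close> sees
        only the coset, and \<open>\<pi> x\<close> lies in that of
        \<open>k \<otimes> x\<close>.\<close>
      have "comm (\<pi> x) g = comm (t (\<pi> x)) g"
        using \<pi>G[OF x] gC by (intro comm_t[symmetric] C_abelian) simp_all
      also have "\<dots> = comm (k \<otimes> x) g"
        unfolding t_\<pi>[OF x] using x k gC by (intro comm_t C_abelian) simp_all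
      finally have "comm (\<pi> x) g = ?w \<otimes> comm x g" using x k g by (simp add: comm_mult_left)
      then have "F (g \<otimes> \<pi> x) \<otimes> inv (F (\<pi> x)) =
          f (g \<otimes> c x) \<otimes> inv (f (c x)) \<otimes> inv (?w \<otimes> comm x g) \<otimes> inv (?w \<otimes> comm x g)"
        using ratio[OF \<pi>G[OF x]] c_\<pi>[OF x] by simp
      also have "\<dots> = f (g \<otimes> c x) \<otimes> inv (f (c x)) \<otimes> inv (comm x g) \<otimes> inv (comm x g) \<otimes> (inv ?w \<otimes> inv ?w)"
        using x g w c[OF x] by (intro Z_square_inv) (simp_all add: fZ comm_center)
      also have "\<dots> = F (g \<otimes> x) \<otimes> inv (F x) \<otimes> (inv ?w \<otimes> inv ?w)"
        by (simp only: ratio[OF x])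
      finally show "F (g \<otimes> \<pi> x) \<otimes> inv (F (\<pi> x)) = F (g \<otimes> x) \<otimes> inv (F x) \<otimes> (inv ?w \<otimes> inv ?w)" .
    qed
  qed
  then show ?thesis using FZ Fz by (intro exI[of _ F]) blast
qed

section \<open>The zero set of the balanced map as a difference set\<close>

text \<open>For \<open>g\<close> outside \<open>Z\<close>, counting \<open>y\<close> with
  \<open>F y = F (g \<otimes> y) = \<one>\<close> uses equidistribution twice: first of the ratio on
  \<open>G\<close>, then of \<open>F\<close> on the set where the ratio is \<open>\<one>\<close>.
  Each use divides by \<open>p\<close>.\<close>

lemma exists_semiregular_rds:
  assumes ord: "order G = p ^ Suc (Suc n)"
  shows "\<exists>D. semiregular_rds G Z D (p ^ Suc n) p (p ^ Suc n) (p ^ n)"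
proof -
  obtain F where FZ: "\<And>x. x \<in> carrier G \<Longrightarrow> F x \<in> Z"
    and Fz: "\<And>x z. x \<in> carrier G \<Longrightarrow> z \<in> Z \<Longrightarrow> F (x \<otimes> z) = F x \<otimes> z"
    and bal: "\<And>g. g \<in> carrier G - Z \<Longrightarrow> \<exists>\<pi> \<zeta>. inj_on \<pi> (carrier G) \<and> \<pi> ` carrier G \<subseteq> carrier G \<and>
       \<zeta> \<in> Z \<and> \<zeta> \<noteq> \<one> \<and>
       (\<forall>x\<in>carrier G. F (g \<otimes> \<pi> x) \<otimes> inv (F (\<pi> x)) = F (g \<otimes> x) \<otimes> inv (F x) \<otimes> \<zeta>)"
    using exists_balanced_map by metis
  define D where "D = {x \<in> carrier G. F x = \<one>}"
  have p0: "p > 0" using prime by (rule prime_gt_0_nat)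
  have "\<not> Z \<subseteq> {\<one>}"
  proof
    assume "Z \<subseteq> {\<one>}"
    then have "card Z \<le> card {\<one>}" by (intro card_mono) auto
    then show False using card_center prime_gt_1_nat[OF prime] by simp
  qed
  then obtain \<zeta> where \<zeta>: "\<zeta> \<in> Z" "\<zeta> \<noteq> \<one>" by blast
  \<comment> \<open>Here \<open>card_fibre\<close> is applied to \<open>F\<close> itself, with
    translation by the central \<open>\<zeta>\<close> as the shift.\<close>
  have zeros: "p * card {x \<in> S. F x = \<one>} = card S"
    if S: "S \<subseteq> carrier G" "\<And>x. x \<in> S \<Longrightarrow> x \<otimes> \<zeta> \<in> S" for S
  proof (rule card_fibre[where \<pi> = "\<lambda>x. x \<otimes> \<zeta>" and \<zeta> = \<zeta>])
    show "finite S" using S(1) fin by (rule finite_subset)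
    show "inj_on (\<lambda>x. x \<otimes> \<zeta>) S" using S(1) \<zeta> by (auto simp: inj_on_def subset_iff)
  qed (use S \<zeta> FZ Fz in auto)
  have cardD: "card D = p ^ Suc n"
    using zeros[of "carrier G"] \<zeta> ord p0 by (simp add: D_def order_def)
  have translates: "card {y \<in> D. g \<otimes> y \<in> D} = p ^ n" if g: "g \<in> carrier G" "g \<notin> Z" for g
  proof -
    let ?\<rho> = "\<lambda>x. F (g \<otimes> x) \<otimes> inv (F x)"
    let ?S = "{x \<in> carrier G. ?\<rho> x = \<one>}"
    obtain \<pi> \<xi> where \<pi>: "inj_on \<pi> (carrier G)" "\<pi> ` carrier G \<subseteq> carrier G" "\<xi> \<in> Z" "\<xi> \<noteq> \<one>"
      "\<And>x. x \<in> carrier G \<Longrightarrow> ?\<rho> (\<pi> x) = ?\<rho> x \<otimes> \<xi>"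
      using bal[of g] g by blast
    have "p * card ?S = card (carrier G)"
      using \<pi> g FZ by (intro card_fibre[where \<pi> = \<pi> and \<zeta> = \<xi>] fin) simp_all
    then have cS: "card ?S = p ^ Suc n" using ord p0 by (simp add: order_def)
    have \<rho>1: "?\<rho> x = \<one> \<longleftrightarrow> F (g \<otimes> x) = F x" if "x \<in> carrier G" for x
    proof
      assume "?\<rho> x = \<one>"
      then show "F (g \<otimes> x) = F x"
        using that g FZ[of x] FZ[of "g \<otimes> x"] by (metis Z_closed inv_closed inv_equality inv_inv m_closed)
    next
      assume "F (g \<otimes> x) = F x"
      then show "?\<rho> x = \<one>" using that FZ[of x] by simp
    qed
    \<comment> \<open>A central factor multiplies \<open>F (g \<otimes> x)\<close> and
      \<open>F x\<close> alike and leaves their ratio unchanged.\<close>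
    have "x \<otimes> \<zeta> \<in> ?S" if "x \<in> ?S" for x
    proof -
      have x: "x \<in> carrier G" "F (g \<otimes> x) = F x" using that \<rho>1 by auto
      have "F (g \<otimes> (x \<otimes> \<zeta>)) = F (x \<otimes> \<zeta>)"
        using x g \<zeta> Fz[of "g \<otimes> x" \<zeta>] by (simp add: Fz m_assoc)
      then show ?thesis using x \<zeta> \<rho>1[of "x \<otimes> \<zeta>"] by simp
    qed
    then have "p * card {x \<in> ?S. F x = \<one>} = card ?S" by (intro zeros) auto
    moreover have "{x \<in> ?S. F x = \<one>} = {y \<in> D. g \<otimes> y \<in> D}"
      using \<rho>1 g unfolding D_def by (smt (verit, best) Collect_cong m_closed mem_Collect_eq)
    ultimately show ?thesis using cS p0 by simp
  qed
  have "relative_difference_set G Z D (p ^ Suc n) p (p ^ Suc n) (p ^ n)"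
    unfolding relative_difference_set_iff_coeff[OF is_group fin subgroup_group_center]
  proof (intro conjI ballI)
    show "D \<subseteq> carrier G" by (auto simp: D_def)
    show "p ^ Suc n = card (rcosets Z)"
      using lagrange[OF subgroup_group_center] card_center ord p0 by simp
    show "p = card Z" "p ^ Suc n = card D" "0 < p ^ n" using card_center cardD p0 by simp_all
  next
    fix g assume g: "g \<in> carrier G"
    \<comment> \<open>A pair with quotient \<open>g\<close> is determined by its second entry, which
      turns the coefficient into the count in \<open>translates\<close>.\<close>
    have "{(x, y) \<in> D \<times> D. x \<otimes> inv y = g} = (\<lambda>y. (g \<otimes> y, y)) ` {y \<in> D. g \<otimes> y \<in> D}"
    proof (intro equalityI subsetI)
      fix q assume "q \<in> {(x, y) \<in> D \<times> D. x \<otimes> inv y = g}"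
      then obtain x y where q: "q = (x, y)" "x \<in> D" "y \<in> D" "x \<otimes> inv y = g" by blast
      then have "g \<otimes> y = x" by (auto simp: D_def m_assoc)
      then show "q \<in> (\<lambda>y. (g \<otimes> y, y)) ` {y \<in> D. g \<otimes> y \<in> D}" using q by auto
    qed (use g in \<open>auto simp: D_def m_assoc\<close>)
    then have card: "card {(x, y) \<in> D \<times> D. x \<otimes> inv y = g} = card {y \<in> D. g \<otimes> y \<in> D}"
      by (simp add: card_image inj_on_def)
    show "int (card {(x, y) \<in> D \<times> D. x \<otimes> inv y = g}) =
       (if g = \<one> then int (p ^ Suc n) else 0) + (if g \<in> Z then 0 else int (p ^ n))"
    proof (cases "g \<in> Z")
      case True
      \<comment> \<open>A central \<open>g\<close> shifts the value of \<open>F\<close> by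
        \<open>g\<close>, so it can map a zero to a zero only if \<open>g = \<one>\<close>.\<close>
      have "F (g \<otimes> y) = F y \<otimes> g" if "y \<in> carrier G" for y
        using that True Fz by (metis Z_commute)
      then have "{y \<in> D. g \<otimes> y \<in> D} = (if g = \<one> then D else {})"
        using g by (auto simp: D_def)
      then show ?thesis using True cardD card by simp
    next
      case False
      then have "g \<noteq> \<one>" by auto
      then show ?thesis using False translates[OF g] card by simp
    qed
  qed
  moreover have "card (D \<inter> (Z #> g)) = 1" if g: "g \<in> carrier G" for g
  proof -
    have zg: "F (z \<otimes> g) = F g \<otimes> z" if "z \<in> Z" for z using g that Fz by (metis Z_commute)
    \<comment> \<open>On this coset \<open>F\<close> takes the value \<open>F g \<otimes> z\<close>
      at \<open>z \<otimes> g\<close>, which is \<open>\<one>\<close> for exactly one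
      \<open>z\<close>.\<close>
    have "D \<inter> (Z #> g) = {inv (F g) \<otimes> g}"
    proof (intro equalityI subsetI)
      fix x assume "x \<in> D \<inter> (Z #> g)"
      then obtain z where z: "z \<in> Z" "x = z \<otimes> g" "F x = \<one>" by (auto simp: D_def r_coset_def)
      then have "F g \<otimes> z = \<one>" using zg by simp
      then have "z = inv (F g)" using z FZ[OF g] by (metis Z_closed Z_commute inv_equality)
      then show "x \<in> {inv (F g) \<otimes> g}" using z by simp
    next
      fix x assume "x \<in> {inv (F g) \<otimes> g}"
      then show "x \<in> D \<inter> (Z #> g)"
        using g FZ[OF g] zg[of "inv (F g)"] by (auto simp: D_def r_coset_def)
    qed
    then show ?thesis by simp
  qed
  ultimately show ?thesis unfolding semiregular_rds_def by blast
qed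

end

section \<open>From the definition of extraspecial groups to the locale\<close>

text \<open>The projection to the quotient by the centre sends commutators and \<open>p\<close>-th
  powers to the identity, and its kernel is the centre.\<close>

lemma extraspecial_groupI:
  fixes G (structure)
  assumes "odd p" "extraspecial p G"
  shows "extraspecial_group G p"
proof -
  interpret group G using assms(2) by (simp add: extraspecial_def)
  interpret N: normal "group_center G" G by (rule normal_group_center)
  let ?Q = "G Mod group_center G"
  have Q: "comm_group ?Q" "\<And>X. X \<in> carrier ?Q \<Longrightarrow> X [^]\<^bsub>?Q\<^esub> p = \<one>\<^bsub>?Q\<^esub>"
    using assms(2) by (auto simp: extraspecial_def elementary_abelian_def)
  let ?q = "\<lambda>x. group_center G #> x"
  have q: "?q x \<in> carrier ?Q" if "x \<in> carrier G" for x
    using that by (auto simp: FactGroup_def RCOSETS_def)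
  have mem: "x \<in> group_center G" if "x \<in> carrier G" "?q x = \<one>\<^bsub>?Q\<^esub>" for x
    using that rcos_self[OF _ subgroup_group_center, of x] by (simp add: FactGroup_def)
  have hom: "?q \<in> hom G ?Q" by (rule N.r_coset_hom_Mod)
  interpret Q: comm_group ?Q by (rule Q(1))
  interpret h: group_hom G ?Q ?q
    using hom by (simp add: group_hom_def group_hom_axioms_def Q.is_group is_group)
  show ?thesis
  proof
    fix x assume x: "x \<in> carrier G"
    show "x [^] p \<in> group_center G"
      using x Q(2)[OF q[OF x]] by (intro mem) (simp_all add: h.hom_nat_pow)
    fix y assume y: "y \<in> carrier G"
    have "?q (commutator G x y) = \<one>\<^bsub>?Q\<^esub>"
      using x y q Q.m_comm[of "?q x" "?q y"]
      by (simp only: commutator_def h.hom_mult h.hom_inv m_closed inv_closed Q.m_assoc Q.m_closed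
          Q.inv_closed Q.inv_mult_cancel Q.r_inv Q.l_one Q.r_one)
    then show "commutator G x y \<in> group_center G" using x y by (intro mem) simp_all
  qed (use assms in \<open>simp_all add: extraspecial_def\<close>)
qed

theorem theorem1p2:
  fixes G :: "('a, 'b) monoid_scheme" and p r :: nat
  assumes "prime p" and "odd p" and "r \<ge> 1"
    and "extraspecial p G" and "order G = p ^ (2 * r + 1)" and "group_exponent G = p ^ 2"
  shows "\<exists>N D. semiregular_rds G N D (p ^ (2 * r)) p (p ^ (2 * r)) (p ^ (2 * r - 1))"
proof -
  interpret extraspecial_group G p using assms by (intro extraspecial_groupI)
  \<comment> \<open>The instance is \<open>n = 2 * r - 1\<close>; \<open>r \<ge> 1\<close> makes the
    truncated subtraction exact.\<close>
  have r: "Suc (Suc (2 * r - 1)) = 2 * r + 1" "Suc (2 * r - 1) = 2 * r" using assms(3) by simp_all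
  show ?thesis using exists_semiregular_rds[of "2 * r - 1"] assms(5) unfolding r by auto
qed

end
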